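(* Let $\alpha,\beta>-1$ and let $P_n[z;\alpha,\beta]$ be the monic Jacobi polynomials written as symmetric Laurent polynomials in $z$. For $n\in\mathbb{Z}$ let $E_n[z;a,b,c,d\mid q]$ be the nonsymmetric Askey-Wilson polynomials (as Laurent polynomials). Then for $z\in\mathbb{C}\setminus\{0\}$ $$\lim_{q\uparrow1}E_{-n}\big[z;q^{\alpha+\frac12},-q^{\beta+\frac12},q^{\frac12},-q^{\frac12}\mid q\big]=P_n[z;\alpha,\beta]-(z-z^{-1})P_{n-1}[z;\alpha+1,\beta+1]\qquad(n=1,2,\ldots),$$ $$\lim_{q\uparrow1}E_{n}\big[z;q^{\alpha+\frac12},-q^{\beta+\frac12},q^{\frac12},-q^{\frac12}\mid q\big]=P_n[z;\alpha,\beta]+\frac{n}{n+\alpha+\beta+1}(z-z^{-1})P_{n-1}[z;\alpha+1,\beta+1]\qquad(n=0,1,2,\ldots),$$ where the term with $nP_{n-1}$ is $0$ for $n=0$.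
   Context: Here $0<q<1$. Pochhammer symbols: $(a;q)_n=\prod_{j=0}^{n-1}(1-aq^j)$, $(a_1,\ldots,a_r;q)_n=(a_1;q)_n\cdots(a_r;q)_n$, and $(a)_n=a(a+1)\cdots(a+n-1)$. Monic Askey-Wilson polynomials: $$P_n[z;a,b,c,d\mid q]=\frac{(ab,ac,ad;q)_n}{a^n(abcdq^{n-1};q)_n}\sum_{k=0}^n\frac{(q^{-n},q^{n-1}abcd,az,az^{-1};q)_k}{(ab,ac,ad,q;q)_k}q^k.$$ Nonsymmetric Askey-Wilson polynomials: with $P_n[z]=P_n[z;a,b,c,d\mid q]$ and $Q_n[z]=a^{-1}b^{-1}z^{-1}(1-az)(1-bz)P_{n-1}[z;qa,qb,c,d\mid q]$, $$E_{-n}=P_n-Q_n\quad(n\ge1),\qquad E_n=P_n-\frac{ab(1-q^n)(1-q^{n-1}cd)}{(1-q^nab)(1-q^{n-1}abcd)}\,Q_n\quad(n\ge0),$$ with the convention $(1-q^n)Q_n=0$ for $n=0$. Monic Jacobi polynomials as symmetric Laurent polynomials: $$P_n[z;\alpha,\beta]=\frac{2^{2n}(\alpha+1)_n}{(n+\alpha+\beta+1)_n}\sum_{k=0}^n\frac{(-n)_k(n+\alpha+\beta+1)_k}{(\alpha+1)_k\,k!}\left(\frac{2-z-z^{-1}}4\right)^k,$$ with $P_0=1$. *)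

theory Defs
  imports Complex_Main
begin

definition qpochhammer :: "complex \<Rightarrow> complex \<Rightarrow> nat \<Rightarrow> complex" where
  "qpochhammer a q n = (\<Prod>j<n. 1 - a * q ^ j)"

text \<open>Laurent polynomials in \<open>z\<close> are rendered as functions of a complex \<open>z\<close>, meaningful for
  \<open>z \<noteq> 0\<close>. The exponent \<open>n - 1\<close> is an integer, so it equals \<open>-1\<close> (not \<open>0\<close>) when \<open>n = 0\<close>.\<close>

definition askey_wilson_monic ::
    "nat \<Rightarrow> complex \<Rightarrow> complex \<Rightarrow> complex \<Rightarrow> complex \<Rightarrow> complex \<Rightarrow> complex \<Rightarrow> complex" where
  "askey_wilson_monic n a b c d q z =
     qpochhammer (a*b) q n * qpochhammer (a*c) q n * qpochhammer (a*d) q n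
       / (a ^ n * qpochhammer (a*b*c*d * q powi (int n - 1)) q n)
     * (\<Sum>k=0..n.
          qpochhammer (q powi (- int n)) q k * qpochhammer (q powi (int n - 1) * a*b*c*d) q k
            * qpochhammer (a * z) q k * qpochhammer (a * inverse z) q k
          / (qpochhammer (a*b) q k * qpochhammer (a*c) q k * qpochhammer (a*d) q k
               * qpochhammer q q k)
          * q ^ k)"

text \<open>The following is used for \<open>n \<ge> 1\<close> only, because of the truncated \<open>n - 1\<close>.\<close>

definition askey_wilson_Q ::
    "nat \<Rightarrow> complex \<Rightarrow> complex \<Rightarrow> complex \<Rightarrow> complex \<Rightarrow> complex \<Rightarrow> complex \<Rightarrow> complex" where
  "askey_wilson_Q n a b c d q z =
     inverse a * inverse b * inverse z * (1 - a*z) * (1 - b*z)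
       * askey_wilson_monic (n - 1) (q*a) (q*b) c d q z"

text \<open>For \<open>m = 0\<close> the second term is \<open>0\<close> by the convention \<open>(1 - q^n) Q\<^sub>n = 0\<close> for \<open>n = 0\<close>.\<close>

definition askey_wilson_nonsym ::
    "int \<Rightarrow> complex \<Rightarrow> complex \<Rightarrow> complex \<Rightarrow> complex \<Rightarrow> complex \<Rightarrow> complex \<Rightarrow> complex" where
  "askey_wilson_nonsym m a b c d q z =
     (let n = nat \<bar>m\<bar> in
      if m < 0 then askey_wilson_monic n a b c d q z - askey_wilson_Q n a b c d q z
      else askey_wilson_monic n a b c d q z
        - (if n = 0 then 0
           else a*b * (1 - q ^ n) * (1 - q powi (int n - 1) * c*d)
                / ((1 - q ^ n * a*b) * (1 - q powi (int n - 1) * a*b*c*d))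
                * askey_wilson_Q n a b c d q z))"

definition jacobi_monic :: "nat \<Rightarrow> real \<Rightarrow> real \<Rightarrow> complex \<Rightarrow> complex" where
  "jacobi_monic n \<alpha> \<beta> z =
     complex_of_real (2 ^ (2*n) * pochhammer (\<alpha> + 1) n / pochhammer (real n + \<alpha> + \<beta> + 1) n)
     * (\<Sum>k=0..n.
          complex_of_real (pochhammer (- real n) k * pochhammer (real n + \<alpha> + \<beta> + 1) k
                             / (pochhammer (\<alpha> + 1) k * fact k))
          * ((2 - z - inverse z) / 4) ^ k)"

end

theory Submission
  imports Defs
begin

text \<open>
  With \<open>a = q\<^bsup>\<alpha>+1/2\<^esup>\<close>, \<open>b = -q\<^bsup>\<beta>+1/2\<^esup>\<close>, \<open>c = q\<^bsup>1/2\<^esup>\<close>, \<open>d = -q\<^bsup>1/2\<^esup>\<close> every parameter without \<open>z\<close> of the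
  basic hypergeometric sum becomes \<open>\<plusminus>\<close> a real power of \<open>q\<close>:
  \<open>ab = -q\<^bsup>\<alpha>+\<beta>+1\<^esup>\<close>, \<open>ac = q\<^bsup>\<alpha>+1\<^esup>\<close>, \<open>ad = -q\<^bsup>\<alpha>+1\<^esup>\<close>, \<open>abcd = q\<^bsup>\<alpha>+\<beta>+2\<^esup>\<close>.
  As \<open>q\<close> tends to 1, two kinds of \<open>q\<close>-shifted factorial occur. If the base
  point is negative or involves \<open>z\<close>, with limit \<open>w\<close>, continuity gives \<open>(1 - w)\<^sup>k\<close>; the negative parameters give
  powers of 2, and \<open>(az, a/z; q)\<^sub>k\<close> gives \<open>(2 - z - 1/z)\<^sup>k\<close>. If the base point is \<open>q\<^sup>s\<close>, every factor
  \<open>1 - q\<^bsup>s+j\<^esup>\<close> tends to 0, but its quotient by \<open>1 - q\<close> tends to \<open>s + j\<close>, the derivative of \<open>q\<^bsup>s+j\<^esup>\<close>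
  at 1; so after division by \<open>(1 - q)\<^sup>k\<close> the limit is the Pochhammer symbol \<open>(s)\<^sub>k\<close>
  (\<open>qpochhammer_powr_tendsto\<close>). In the prefactor of \<open>P\<^sub>n\<close> and in every summand, numerator and
  denominator contain equally many factorials of the second kind, so the powers of \<open>1 - q\<close> cancel
  and the limit may be taken term by term; the result is the Jacobi polynomial
  (\<open>askey_wilson_monic_tendsto_jacobi\<close>). The hypothesis \<open>\<alpha>, \<beta> > -1\<close> keeps the limiting denominators
  \<open>(\<alpha>+1)\<^sub>k\<close> and \<open>(n+\<alpha>+\<beta>+1)\<^sub>n\<close> nonzero (the latter is an empty product for \<open>n = 0\<close>).

  Passing from \<open>(a, b)\<close> to \<open>(qa, qb)\<close> raises \<open>\<alpha>\<close> and \<open>\<beta>\<close> by 1, and the prefactor of \<open>Q\<^sub>n\<close> tends to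
  \<open>-z\<^sup>-\<^sup>1 (1 - z) (1 + z) = z - z\<^sup>-\<^sup>1\<close>. The coefficient of \<open>Q\<^sub>n\<close> in \<open>E\<^sub>n\<close> contributes
  \<open>ab \<rightarrow> -1\<close>, a quotient of two factors that both tend to 2, and
  \<open>(1 - q\<^sup>n) / (1 - q\<^bsup>n+\<alpha>+\<beta>+1\<^esup>) \<rightarrow> n / (n+\<alpha>+\<beta>+1)\<close>.
\<close>

section \<open>Limits of powers of q and of q-shifted factorials\<close>

lemma eventually_at_left_1_in_unit:
  "eventually (\<lambda>q::real. 0 < q \<and> q < 1) (at_left 1)"
  using eventually_at_left_real[of 0 "1::real"] by simp

lemma of_real_at_left_1_tendsto:
  "((\<lambda>q::real. complex_of_real q) \<longlongrightarrow> 1) (at_left 1)"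
  using tendsto_of_real[OF tendsto_ident_at[of "1::real" "{..<1}"], where 'a=complex] by simp

lemma of_real_powr_at_left_1_tendsto:
  "((\<lambda>q::real. complex_of_real (q powr s)) \<longlongrightarrow> 1) (at_left 1)"
proof -
  have "((\<lambda>q::real. q powr s) \<longlongrightarrow> 1 powr s) (at_left 1)"
    by (intro tendsto_intros) auto
  from tendsto_of_real[OF this, where 'a=complex] show ?thesis by simp
qed

text \<open>The quotient is the difference quotient of \<open>q\<^sup>s\<close> at \<open>q = 1\<close>.\<close>

lemma q_number_tendsto:
  "((\<lambda>q::real. (1 - complex_of_real (q powr s)) / (1 - complex_of_real q)) \<longlongrightarrow> of_real s) (at_left 1)"
proof -
  have "((\<lambda>q::real. q powr s) has_real_derivative s) (at 1)"
    by (auto intro!: derivative_eq_intros)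
  then have "((\<lambda>q::real. (q powr s - 1) / (q - 1)) \<longlongrightarrow> s) (at 1)"
    by (simp add: has_field_derivative_iff)
  then have "((\<lambda>q::real. (q powr s - 1) / (q - 1)) \<longlongrightarrow> s) (at_left 1)"
    by (rule tendsto_within_subset) simp
  moreover have "(\<lambda>q::real. (q powr s - 1) / (q - 1)) = (\<lambda>q. (1 - q powr s) / (1 - q))"
    by (rule ext) (metis minus_diff_eq minus_divide_divide)
  ultimately have "((\<lambda>q::real. (1 - q powr s) / (1 - q)) \<longlongrightarrow> s) (at_left 1)"
    by simp
  from tendsto_of_real[OF this, where 'a=complex] show ?thesis by simp
qed

lemma qpochhammer_tendsto_power:
  assumes "(f \<longlongrightarrow> c) (at_left (1::real))"
  shows "((\<lambda>q. qpochhammer (f q) (of_real q) k) \<longlongrightarrow> (1 - c) ^ k) (at_left 1)"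
proof -
  have "((\<lambda>q. \<Prod>j<k. 1 - f q * of_real q ^ j) \<longlongrightarrow> (\<Prod>j<k. 1 - c * 1 ^ j)) (at_left 1)"
    by (intro tendsto_intros assms of_real_at_left_1_tendsto)
  then show ?thesis by (simp add: qpochhammer_def)
qed

lemma qpochhammer_powr_tendsto:
  "((\<lambda>q::real. qpochhammer (of_real (q powr s)) (of_real q) k / (1 - of_real q) ^ k)
     \<longlongrightarrow> of_real (pochhammer s k)) (at_left 1)"
proof (rule Lim_transform_eventually)
  show "((\<lambda>q::real. \<Prod>j<k. (1 - complex_of_real (q powr (s + real j))) / (1 - of_real q))
     \<longlongrightarrow> of_real (pochhammer s k)) (at_left 1)"
    unfolding pochhammer_prod of_real_prod lessThan_atLeast0
    by (intro tendsto_prod) (use q_number_tendsto[of "s + real j" for j] in simp)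
  show "\<forall>\<^sub>F q in at_left 1. (\<Prod>j<k. (1 - complex_of_real (q powr (s + real j))) / (1 - of_real q))
     = qpochhammer (of_real (q powr s)) (of_real q) k / (1 - of_real q) ^ k"
    using eventually_at_left_1_in_unit
  proof eventually_elim
    case (elim q)
    then have "q powr (s + real j) = q powr s * q ^ j" for j
      by (simp add: powr_add powr_realpow)
    then show ?case
      by (simp add: qpochhammer_def prod_dividef)
  qed
qed

section \<open>The limit of the monic Askey-Wilson polynomials\<close>

text \<open>Each of the four powers of \<open>1 - q\<close> is attached to the factorial that vanishes with it, which
  makes every factor of a summand convergent.\<close>

lemma askey_wilson_summand_tendsto:
  fixes z :: complex
  assumes "s > 0"
  shows "((\<lambda>q::real.
            qpochhammer (of_real (q powr (- real n))) (of_real q) k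
            * qpochhammer (of_real (q powr t)) (of_real q) k
            * qpochhammer (of_real (q powr r) * z) (of_real q) k
            * qpochhammer (of_real (q powr r) * inverse z) (of_real q) k
          / (qpochhammer (- of_real (q powr u)) (of_real q) k
             * qpochhammer (of_real (q powr s)) (of_real q) k
             * qpochhammer (- of_real (q powr v)) (of_real q) k
             * qpochhammer (of_real q) (of_real q) k)
          * of_real q ^ k)
     \<longlongrightarrow> of_real (pochhammer (- real n) k * pochhammer t k / (pochhammer s k * fact k))
         * ((1 - z) * (1 - inverse z) / 4) ^ k) (at_left 1)"
proof (rule Lim_transform_eventually)
  define h where "h q = (1 - complex_of_real q) ^ k" for q
  define A where "A w q = qpochhammer (complex_of_real (q powr w)) (of_real q) k" for w q
  define B where "B f q = qpochhammer (f q) (complex_of_real q) k" for f q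
  have A: "((\<lambda>q. A w q / h q) \<longlongrightarrow> of_real (pochhammer w k)) (at_left 1)" for w
    unfolding A_def h_def by (rule qpochhammer_powr_tendsto)
  have B: "(f \<longlongrightarrow> c) (at_left 1) \<Longrightarrow> (B f \<longlongrightarrow> (1 - c) ^ k) (at_left 1)" for f c
    unfolding B_def by (rule qpochhammer_tendsto_power)
  note powr = of_real_powr_at_left_1_tendsto
  have Bz: "(B (\<lambda>q. of_real (q powr r) * w) \<longlongrightarrow> (1 - w) ^ k) (at_left 1)" for w
    using tendsto_mult[OF powr tendsto_const, of r w] by (intro B) simp
  have Bm: "(B (\<lambda>q. - of_real (q powr w)) \<longlongrightarrow> 2 ^ k) (at_left 1)" for w
    using B[OF tendsto_minus[OF powr, of w]] by simp
  let ?F = "\<lambda>q. (A (- real n) q / h q) * (A t q / h q)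
       * B (\<lambda>q. of_real (q powr r) * z) q * B (\<lambda>q. of_real (q powr r) * inverse z) q
     / (B (\<lambda>q. - of_real (q powr u)) q * (A s q / h q) * B (\<lambda>q. - of_real (q powr v)) q
         * (A 1 q / h q)) * of_real q ^ k"
  have nz: "pochhammer s k \<noteq> 0"
    using pochhammer_pos[OF assms, of k] by simp
  have "(?F \<longlongrightarrow> of_real (pochhammer (- real n) k) * of_real (pochhammer t k)
       * (1 - z) ^ k * (1 - inverse z) ^ k
     / (2 ^ k * of_real (pochhammer s k) * 2 ^ k * of_real (pochhammer 1 k)) * 1 ^ k) (at_left 1)"
    using nz by (intro tendsto_intros A Bz Bm of_real_at_left_1_tendsto)
      (simp add: pochhammer_fact [symmetric])
  moreover have "(4::complex) ^ k = 2 ^ k * 2 ^ k"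
    by (simp flip: power_mult_distrib)
  ultimately show "(?F \<longlongrightarrow> of_real (pochhammer (- real n) k * pochhammer t k / (pochhammer s k * fact k))
         * ((1 - z) * (1 - inverse z) / 4) ^ k) (at_left 1)"
    by (simp add: pochhammer_fact [symmetric] power_mult_distrib power_divide mult_ac)
  show "\<forall>\<^sub>F q in at_left 1. ?F q =
            qpochhammer (of_real (q powr (- real n))) (of_real q) k
            * qpochhammer (of_real (q powr t)) (of_real q) k
            * qpochhammer (of_real (q powr r) * z) (of_real q) k
            * qpochhammer (of_real (q powr r) * inverse z) (of_real q) k
          / (qpochhammer (- of_real (q powr u)) (of_real q) k
             * qpochhammer (of_real (q powr s)) (of_real q) k
             * qpochhammer (- of_real (q powr v)) (of_real q) k
             * qpochhammer (of_real q) (of_real q) k)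
          * of_real q ^ k"
    using eventually_at_left_1_in_unit
  proof eventually_elim
    case (elim q)
    then have "h q \<noteq> 0" by (simp add: h_def)
    moreover have "A 1 q = qpochhammer (of_real q) (of_real q) k"
      using elim by (simp add: A_def)
    ultimately show ?case
      unfolding A_def [symmetric] B_def by simp
  qed
qed

text \<open>In the application \<open>t = n+\<alpha>+\<beta>+1\<close>. This can be negative or zero if \<open>n = 0\<close>, and then the product
  in the denominator is empty; hence the conditional form of the hypothesis.\<close>

lemma askey_wilson_prefactor_tendsto:
  assumes "n \<noteq> 0 \<Longrightarrow> t > 0"
  shows "((\<lambda>q::real.
            qpochhammer (- of_real (q powr u)) (of_real q) n
            * qpochhammer (of_real (q powr s)) (of_real q) n
            * qpochhammer (- of_real (q powr v)) (of_real q) n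
          / (of_real (q powr r) ^ n * qpochhammer (of_real (q powr t)) (of_real q) n))
     \<longlongrightarrow> complex_of_real (2 ^ (2 * n) * pochhammer s n / pochhammer t n)) (at_left 1)"
proof (rule Lim_transform_eventually)
  define h where "h q = (1 - complex_of_real q) ^ n" for q
  define A where "A w q = qpochhammer (complex_of_real (q powr w)) (of_real q) n" for w q
  define B where "B w q = qpochhammer (- complex_of_real (q powr w)) (of_real q) n" for w q
  have A: "((\<lambda>q. A w q / h q) \<longlongrightarrow> of_real (pochhammer w n)) (at_left 1)" for w
    unfolding A_def h_def by (rule qpochhammer_powr_tendsto)
  have B: "(B w \<longlongrightarrow> 2 ^ n) (at_left 1)" for w
    unfolding B_def
    using qpochhammer_tendsto_power[OF tendsto_minus[OF of_real_powr_at_left_1_tendsto, of w], of n] by simp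
  have nz: "pochhammer t n \<noteq> 0"
    using pochhammer_pos[of t n] assms by (cases "n = 0") auto
  let ?F = "\<lambda>q. B u q * (A s q / h q) * B v q / (of_real (q powr r) ^ n * (A t q / h q))"
  have "(?F \<longlongrightarrow> 2 ^ n * of_real (pochhammer s n) * 2 ^ n / (1 ^ n * of_real (pochhammer t n))) (at_left 1)"
    using nz by (intro tendsto_intros A B of_real_powr_at_left_1_tendsto) simp
  moreover have "2 ^ n * of_real (pochhammer s n) * 2 ^ n / (1 ^ n * of_real (pochhammer t n))
      = complex_of_real (2 ^ (2 * n) * pochhammer s n / pochhammer t n)"
    by (simp add: mult_2 power_add)
  ultimately show "(?F \<longlongrightarrow> complex_of_real (2 ^ (2 * n) * pochhammer s n / pochhammer t n)) (at_left 1)"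
    by (simp only:)
  show "\<forall>\<^sub>F q in at_left 1. ?F q =
            qpochhammer (- of_real (q powr u)) (of_real q) n
            * qpochhammer (of_real (q powr s)) (of_real q) n
            * qpochhammer (- of_real (q powr v)) (of_real q) n
          / (of_real (q powr r) ^ n * qpochhammer (of_real (q powr t)) (of_real q) n)"
    using eventually_at_left_1_in_unit
  proof eventually_elim
    case (elim q)
    then have "h q \<noteq> 0" by (simp add: h_def)
    then show ?case
      unfolding A_def [symmetric] B_def [symmetric] by simp
  qed
qed

lemma of_real_powi_eq_powr:
  assumes "q > 0"
  shows "complex_of_real q powi m = of_real (q powr real_of_int m)"
  using assms by (simp add: powr_real_of_int')

lemma powr_half_mult_negated:
  assumes "q > 0"
  shows "complex_of_real (q powr (1/2)) * of_real (- (q powr (1/2))) = - of_real q"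
proof -
  have "q powr (1/2) * q powr (1/2) = q"
    using assms powr_add[of q "1/2" "1/2"] by simp
  then show ?thesis
    unfolding of_real_mult [symmetric] of_real_minus [symmetric] by (simp only: mult_minus_right)
qed

lemma askey_wilson_monic_tendsto_jacobi:
  fixes \<alpha> \<beta> :: real and z :: complex
  assumes "\<alpha> > -1" and "\<beta> > -1" and "z \<noteq> 0"
  shows "((\<lambda>q::real. askey_wilson_monic n
             (of_real (q powr (\<alpha> + 1/2))) (of_real (- (q powr (\<beta> + 1/2))))
             (of_real (q powr (1/2))) (of_real (- (q powr (1/2)))) (of_real q) z)
          \<longlongrightarrow> jacobi_monic n \<alpha> \<beta> z) (at_left 1)"
proof (rule Lim_transform_eventually)
  define t where "t = real n + \<alpha> + \<beta> + 1"
  let ?P = "\<lambda>q::real. qpochhammer (- of_real (q powr (\<alpha> + \<beta> + 1))) (of_real q) n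
            * qpochhammer (of_real (q powr (\<alpha> + 1))) (of_real q) n
            * qpochhammer (- of_real (q powr (\<alpha> + 1))) (of_real q) n
          / (of_real (q powr (\<alpha> + 1/2)) ^ n * qpochhammer (of_real (q powr t)) (of_real q) n)"
  let ?S = "\<lambda>k (q::real). qpochhammer (of_real (q powr (- real n))) (of_real q) k
            * qpochhammer (of_real (q powr t)) (of_real q) k
            * qpochhammer (of_real (q powr (\<alpha> + 1/2)) * z) (of_real q) k
            * qpochhammer (of_real (q powr (\<alpha> + 1/2)) * inverse z) (of_real q) k
          / (qpochhammer (- of_real (q powr (\<alpha> + \<beta> + 1))) (of_real q) k
             * qpochhammer (of_real (q powr (\<alpha> + 1))) (of_real q) k
             * qpochhammer (- of_real (q powr (\<alpha> + 1))) (of_real q) k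
             * qpochhammer (of_real q) (of_real q) k)
          * of_real q ^ k"
  have z: "(1 - z) * (1 - inverse z) = 2 - z - inverse z"
    using assms(3) by (simp add: algebra_simps)
  have "n \<noteq> 0 \<Longrightarrow> t > 0"
    using assms(1,2) unfolding t_def by (cases n) auto
  moreover have "\<alpha> + 1 > 0" using assms(1) by simp
  ultimately show "((\<lambda>q. ?P q * (\<Sum>k=0..n. ?S k q)) \<longlongrightarrow> jacobi_monic n \<alpha> \<beta> z) (at_left 1)"
    unfolding jacobi_monic_def t_def [symmetric] z [symmetric]
    by (intro tendsto_mult tendsto_sum askey_wilson_prefactor_tendsto askey_wilson_summand_tendsto)
  show "\<forall>\<^sub>F q in at_left 1. ?P q * (\<Sum>k=0..n. ?S k q) = askey_wilson_monic n
             (of_real (q powr (\<alpha> + 1/2))) (of_real (- (q powr (\<beta> + 1/2))))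
             (of_real (q powr (1/2))) (of_real (- (q powr (1/2)))) (of_real q) z"
    using eventually_at_left_1_in_unit
  proof eventually_elim
    case (elim q)
    let ?a = "complex_of_real (q powr (\<alpha> + 1/2))" and ?b = "complex_of_real (- (q powr (\<beta> + 1/2)))"
    let ?c = "complex_of_real (q powr (1/2))" and ?d = "complex_of_real (- (q powr (1/2)))"
    have ab: "?a * ?b = - of_real (q powr (\<alpha> + \<beta> + 1))"
      by (simp flip: of_real_mult powr_add add: add_ac)
    have ac: "?a * ?c = of_real (q powr (\<alpha> + 1))"
      by (simp flip: of_real_mult powr_add add: add_ac)
    have ad: "?a * ?d = - of_real (q powr (\<alpha> + 1))"
      by (simp flip: of_real_mult powr_add add: add_ac)
    have cd: "?c * ?d = - of_real q"
      by (rule powr_half_mult_negated) (use elim in simp)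
    have pn: "complex_of_real q powi (int n - 1) = of_real (q powr (real n - 1))"
      using of_real_powi_eq_powr[of q "int n - 1"] elim by simp
    have "q powr (\<alpha> + \<beta> + 1) * q = q powr (\<alpha> + \<beta> + 2)"
      using elim powr_add[of q "\<alpha> + \<beta> + 1" 1] by (simp add: add_ac)
    then have "?a * ?b * ?c * ?d = of_real (q powr (\<alpha> + \<beta> + 2))"
      unfolding mult.assoc[of "?a * ?b" ?c ?d] unfolding ab cd by (simp flip: of_real_mult)
    moreover have "q powr (\<alpha> + \<beta> + 2) * q powr (real n - 1) = q powr t"
      unfolding t_def powr_add [symmetric] by (simp add: algebra_simps)
    ultimately have abcd: "?a * ?b * ?c * ?d * of_real q powi (int n - 1) = of_real (q powr t)"
      unfolding pn by (simp flip: of_real_mult)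
    have abcd': "of_real q powi (int n - 1) * ?a * ?b * ?c * ?d = of_real (q powr t)"
      unfolding abcd [symmetric] by (simp only: mult_ac)
    have mn: "complex_of_real q powi (- int n) = of_real (q powr (- real n))"
      using of_real_powi_eq_powr[of q "- int n"] elim by simp
    show ?case
      unfolding askey_wilson_monic_def abcd abcd' unfolding ab ac ad mn ..
  qed
qed

section \<open>The limit of the nonsymmetric Askey-Wilson polynomials\<close>

text \<open>Since \<open>(qa, qb)\<close> is \<open>(a, b)\<close> with \<open>\<alpha>\<close> and \<open>\<beta>\<close> raised by 1, the limit of \<open>P\<^bsub>n-1\<^esub>\<close> applies. The
  factor \<open>z - z\<^sup>-\<^sup>1\<close> arises because \<open>b\<close> tends to \<open>-1\<close> while \<open>a\<close> tends to 1.\<close>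

lemma askey_wilson_Q_tendsto_jacobi:
  fixes \<alpha> \<beta> :: real and z :: complex
  assumes "\<alpha> > -1" and "\<beta> > -1" and "z \<noteq> 0"
  shows "((\<lambda>q::real. askey_wilson_Q n
             (of_real (q powr (\<alpha> + 1/2))) (of_real (- (q powr (\<beta> + 1/2))))
             (of_real (q powr (1/2))) (of_real (- (q powr (1/2)))) (of_real q) z)
          \<longlongrightarrow> (z - inverse z) * jacobi_monic (n - 1) (\<alpha> + 1) (\<beta> + 1) z) (at_left 1)"
proof (rule Lim_transform_eventually)
  let ?a = "\<lambda>q. complex_of_real (q powr (\<alpha> + 1/2))"
  let ?b = "\<lambda>q. complex_of_real (- (q powr (\<beta> + 1/2)))"
  let ?F = "\<lambda>q. inverse (?a q) * inverse (?b q) * inverse z * (1 - ?a q * z) * (1 - ?b q * z)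
     * askey_wilson_monic (n - 1)
             (of_real (q powr ((\<alpha> + 1) + 1/2))) (of_real (- (q powr ((\<beta> + 1) + 1/2))))
             (of_real (q powr (1/2))) (of_real (- (q powr (1/2)))) (of_real q) z"
  have b: "(?b \<longlongrightarrow> -1) (at_left 1)"
    using tendsto_minus[OF of_real_powr_at_left_1_tendsto] by simp
  have "(?F \<longlongrightarrow> inverse 1 * inverse (-1) * inverse z * (1 - 1 * z) * (1 - (-1) * z)
      * jacobi_monic (n - 1) (\<alpha> + 1) (\<beta> + 1) z) (at_left 1)"
    using assms
    by (intro tendsto_intros b of_real_powr_at_left_1_tendsto askey_wilson_monic_tendsto_jacobi) auto
  moreover have "inverse 1 * inverse (-1) * inverse z * (1 - 1 * z) * (1 - (-1) * z) = z - inverse z"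
    using assms(3) by (simp add: field_simps)
  ultimately show "(?F \<longlongrightarrow> (z - inverse z) * jacobi_monic (n - 1) (\<alpha> + 1) (\<beta> + 1) z) (at_left 1)"
    by (simp only:)
  show "\<forall>\<^sub>F q in at_left 1. ?F q = askey_wilson_Q n (?a q) (?b q)
             (of_real (q powr (1/2))) (of_real (- (q powr (1/2)))) (of_real q) z"
    using eventually_at_left_1_in_unit
  proof eventually_elim
    case (elim q)
    have "q * q powr (s + 1/2) = q powr ((s + 1) + 1/2)" for s
      using elim powr_add[of q 1 "s + 1/2"] by (simp add: add_ac)
    then have "of_real q * ?a q = of_real (q powr ((\<alpha> + 1) + 1/2))"
      and "of_real q * ?b q = of_real (- (q powr ((\<beta> + 1) + 1/2)))"
      by (simp_all flip: of_real_mult)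
    then show ?case by (simp only: askey_wilson_Q_def)
  qed
qed

text \<open>The coefficient equals \<open>-q\<^bsup>\<alpha>+\<beta>+1\<^esup> (1 - q\<^sup>n) (1 + q\<^sup>n) / ((1 + q\<^sup>t) (1 - q\<^sup>t))\<close> with
  \<open>t = n+\<alpha>+\<beta>+1\<close>. Only one factor above and one below vanish at \<open>q = 1\<close>.\<close>

lemma nonsym_coefficient_tendsto:
  fixes \<alpha> \<beta> :: real
  assumes "\<alpha> > -1" and "\<beta> > -1" and "n \<ge> 1"
  defines "a \<equiv> \<lambda>q::real. complex_of_real (q powr (\<alpha> + 1/2))"
    and "b \<equiv> \<lambda>q::real. complex_of_real (- (q powr (\<beta> + 1/2)))"
    and "c \<equiv> \<lambda>q::real. complex_of_real (q powr (1/2))"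
    and "d \<equiv> \<lambda>q::real. complex_of_real (- (q powr (1/2)))"
  shows "((\<lambda>q. a q * b q * (1 - of_real q ^ n) * (1 - of_real q powi (int n - 1) * c q * d q)
            / ((1 - of_real q ^ n * a q * b q)
               * (1 - of_real q powi (int n - 1) * a q * b q * c q * d q)))
          \<longlongrightarrow> - of_real (real n / (real n + \<alpha> + \<beta> + 1))) (at_left 1)"
proof (rule Lim_transform_eventually)
  define t where "t = real n + \<alpha> + \<beta> + 1"
  have t: "t > 0" using assms(1-3) by (simp add: t_def)
  let ?q = "\<lambda>s q. complex_of_real (q powr s)"
  let ?F = "\<lambda>q. - ?q (\<alpha> + \<beta> + 1) q * ((1 - ?q (real n) q) / (1 - of_real q)) * (1 + ?q (real n) q)
     / ((1 + ?q t q) * ((1 - ?q t q) / (1 - of_real q)))"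
  have "(?F \<longlongrightarrow> - 1 * of_real (real n) * (1 + 1) / ((1 + 1) * of_real t)) (at_left 1)"
    using t by (intro tendsto_intros of_real_powr_at_left_1_tendsto q_number_tendsto) simp
  then show "(?F \<longlongrightarrow> - of_real (real n / (real n + \<alpha> + \<beta> + 1))) (at_left 1)"
    unfolding t_def [symmetric] by simp
  show "\<forall>\<^sub>F q in at_left 1. ?F q =
            a q * b q * (1 - of_real q ^ n) * (1 - of_real q powi (int n - 1) * c q * d q)
            / ((1 - of_real q ^ n * a q * b q)
               * (1 - of_real q powi (int n - 1) * a q * b q * c q * d q))"
    using eventually_at_left_1_in_unit
  proof eventually_elim
    case (elim q)
    have ab: "a q * b q = - ?q (\<alpha> + \<beta> + 1) q"
      unfolding a_def b_def by (simp flip: of_real_mult powr_add add: add_ac)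
    have cd: "c q * d q = - of_real q"
      unfolding c_def d_def by (rule powr_half_mult_negated) (use elim in simp)
    have qn: "complex_of_real q ^ n = ?q (real n) q"
      using elim by (simp add: powr_realpow)
    have qn1: "of_real q powi (int n - 1) = complex_of_real q ^ (n - 1)"
      using assms(3) by (simp add: power_int_def nat_diff_distrib)
    have e1: "of_real q powi (int n - 1) * c q * d q = - ?q (real n) q"
      unfolding qn1 mult.assoc cd qn [symmetric] using assms(3) by (cases n) auto
    have e2: "of_real q ^ n * a q * b q = - ?q t q"
      unfolding mult.assoc ab qn t_def by (simp flip: of_real_mult powr_add add: algebra_simps)
    have "of_real q powi (int n - 1) * a q * b q * c q * d q
        = a q * b q * (of_real q powi (int n - 1) * c q * d q)"
      by (simp only: mult_ac)
    also have "\<dots> = ?q t q"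
      unfolding e1 ab t_def by (simp flip: of_real_mult powr_add add: algebra_simps)
    finally have e3: "of_real q powi (int n - 1) * a q * b q * c q * d q = ?q t q" .
    have "1 - complex_of_real q \<noteq> 0" using elim by simp
    then show ?case
      unfolding e1 e2 e3 ab unfolding qn by simp
  qed
qed

theorem mainTheorem5:
  fixes \<alpha> \<beta> :: real and z :: complex
  assumes "\<alpha> > -1" and "\<beta> > -1" and "z \<noteq> 0"
  shows "(\<forall>n::nat. n \<ge> 1 \<longrightarrow>
           ((\<lambda>q::real. askey_wilson_nonsym (- int n)
               (of_real (q powr (\<alpha> + 1/2))) (of_real (- (q powr (\<beta> + 1/2))))
               (of_real (q powr (1/2))) (of_real (- (q powr (1/2)))) (of_real q) z)
            \<longlongrightarrow> jacobi_monic n \<alpha> \<beta> z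
                  - (z - inverse z) * jacobi_monic (n - 1) (\<alpha> + 1) (\<beta> + 1) z) (at_left 1))
       \<and> (\<forall>n::nat.
           ((\<lambda>q::real. askey_wilson_nonsym (int n)
               (of_real (q powr (\<alpha> + 1/2))) (of_real (- (q powr (\<beta> + 1/2))))
               (of_real (q powr (1/2))) (of_real (- (q powr (1/2)))) (of_real q) z)
            \<longlongrightarrow> jacobi_monic n \<alpha> \<beta> z
                  + (if n = 0 then 0
                     else of_real (real n / (real n + \<alpha> + \<beta> + 1)) * (z - inverse z)
                          * jacobi_monic (n - 1) (\<alpha> + 1) (\<beta> + 1) z)) (at_left 1))"
proof (intro conjI allI impI)
  note P = askey_wilson_monic_tendsto_jacobi[OF assms]
    and Q = askey_wilson_Q_tendsto_jacobi[OF assms]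
  fix n :: nat
  show "((\<lambda>q::real. askey_wilson_nonsym (- int n)
               (of_real (q powr (\<alpha> + 1/2))) (of_real (- (q powr (\<beta> + 1/2))))
               (of_real (q powr (1/2))) (of_real (- (q powr (1/2)))) (of_real q) z)
            \<longlongrightarrow> jacobi_monic n \<alpha> \<beta> z
                  - (z - inverse z) * jacobi_monic (n - 1) (\<alpha> + 1) (\<beta> + 1) z) (at_left 1)"
    if "n \<ge> 1"
    using that tendsto_diff[OF P Q, of n n] by (simp add: askey_wilson_nonsym_def)
  show "((\<lambda>q::real. askey_wilson_nonsym (int n)
               (of_real (q powr (\<alpha> + 1/2))) (of_real (- (q powr (\<beta> + 1/2))))
               (of_real (q powr (1/2))) (of_real (- (q powr (1/2)))) (of_real q) z)
            \<longlongrightarrow> jacobi_monic n \<alpha> \<beta> z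
                  + (if n = 0 then 0
                     else of_real (real n / (real n + \<alpha> + \<beta> + 1)) * (z - inverse z)
                          * jacobi_monic (n - 1) (\<alpha> + 1) (\<beta> + 1) z)) (at_left 1)"
  proof (cases "n = 0")
    case True
    then show ?thesis using P[of 0] by (simp add: askey_wilson_nonsym_def)
  next
    case False
    then have "n \<ge> 1" by simp
    from tendsto_diff[OF P tendsto_mult[OF nonsym_coefficient_tendsto[OF assms(1,2) this] Q], of n n] False
    show ?thesis by (simp add: askey_wilson_nonsym_def mult.assoc)
  qed
qed

end
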